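(* Let $n\ge 1$. A segmented permutation of $[n]$ is a permutation $\sigma=\sigma_1\cdots\sigma_n$ of $[n]$ together with a choice, for each slot between consecutive letters $\sigma_i,\sigma_{i+1}$ ($1\le i\le n-1$), of whether a bar is placed there; let $\mathcal{SP}_n$ be the set of these. For $\sigma\in\mathcal{SP}_n$ define $\mathcal{DT}(\sigma)=\{\sigma_i:\sigma_i>\sigma_{i+1}$ and there is no bar between $\sigma_i$ and $\sigma_{i+1}\}$, $\mathcal{AT}(\sigma)=\{\sigma_{i+1}:\sigma_i<\sigma_{i+1}$ and there is no bar between $\sigma_i$ and $\sigma_{i+1}\}$, $\mathcal{DTS}(\sigma)=\{\sigma_i:\sigma_i>\sigma_{i+1}$ and there is a bar between $\sigma_i$ and $\sigma_{i+1}\}$, $\mathcal{ATS}(\sigma)=\{\sigma_{i+1}:\sigma_i<\sigma_{i+1}$ and there is a bar between $\sigma_i$ and $\sigma_{i+1}\}$. For a subset $S\subseteq[n]$ write $\mathbf{x}^S=\prod_{i\in S}x_i$, and similarly for $\mathbf{y},\mathbf{z},\mathbf{w}$. Define the polynomial in the $4n$ variables $\mathbf{x}=(x_1,\dots,x_n)$, $\mathbf{y}$, $\mathbf{z}$, $\mathbf{w}$ $$\boldsymbol{\alpha}_n(\mathbf{x},\mathbf{y},\mathbf{z},\mathbf{w})=\sum_{\sigma\in\mathcal{SP}_n}\mathbf{x}^{\mathcal{DT}(\sigma)}\mathbf{y}^{\mathcal{AT}(\sigma)}\mathbf{z}^{\mathcal{DTS}(\sigma)}\mathbf{w}^{\mathcal{ATS}(\sigma)}.$$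 Then $\boldsymbol{\alpha}_n$ is (real) stable, i.e. it does not vanish whenever all $4n$ variables lie in the open upper half-plane $\{z\in\mathbb{C}:\mathrm{Im}(z)>0\}$.
   Context: A polynomial with real coefficients is called (real) stable if it is identically zero or has no zero with all coordinates in the open upper half-plane. *)

theory Defs
  imports Complex_Main "HOL-Combinatorics.Permutations"
begin

text \<open>A segmented permutation of \<open>[n]\<close> is a pair \<open>(\<sigma>, B)\<close>, where \<open>i \<in> B\<close> means that a bar is
  placed in the slot between the letters \<open>\<sigma> i\<close> and \<open>\<sigma> (i + 1)\<close>.\<close>

definition SP :: "nat \<Rightarrow> ((nat \<Rightarrow> nat) \<times> nat set) set" where
  "SP n = {(\<sigma>, B). \<sigma> permutes {1..n} \<and> B \<subseteq> {1..<n}}"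

definition DT :: "nat \<Rightarrow> (nat \<Rightarrow> nat) \<times> nat set \<Rightarrow> nat set" where
  "DT n = (\<lambda>(\<sigma>, B). {\<sigma> i | i. i \<in> {1..<n} \<and> \<sigma> i > \<sigma> (i + 1) \<and> i \<notin> B})"

definition AT :: "nat \<Rightarrow> (nat \<Rightarrow> nat) \<times> nat set \<Rightarrow> nat set" where
  "AT n = (\<lambda>(\<sigma>, B). {\<sigma> (i + 1) | i. i \<in> {1..<n} \<and> \<sigma> i < \<sigma> (i + 1) \<and> i \<notin> B})"

definition DTS :: "nat \<Rightarrow> (nat \<Rightarrow> nat) \<times> nat set \<Rightarrow> nat set" where
  "DTS n = (\<lambda>(\<sigma>, B). {\<sigma> i | i. i \<in> {1..<n} \<and> \<sigma> i > \<sigma> (i + 1) \<and> i \<in> B})"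

definition ATS :: "nat \<Rightarrow> (nat \<Rightarrow> nat) \<times> nat set \<Rightarrow> nat set" where
  "ATS n = (\<lambda>(\<sigma>, B). {\<sigma> (i + 1) | i. i \<in> {1..<n} \<and> \<sigma> i < \<sigma> (i + 1) \<and> i \<in> B})"

text \<open>The polynomial is given by its evaluation at a point; only the values of \<open>x\<close>, \<open>y\<close>, \<open>z\<close>, \<open>w\<close>
  at the indices \<open>1, \<dots>, n\<close> enter.\<close>

definition alpha ::
    "nat \<Rightarrow> (nat \<Rightarrow> 'a) \<Rightarrow> (nat \<Rightarrow> 'a) \<Rightarrow> (nat \<Rightarrow> 'a) \<Rightarrow> (nat \<Rightarrow> 'a) \<Rightarrow> 'a::comm_semiring_1" where
  "alpha n x y z w =
     (\<Sum>s\<in>SP n. (\<Prod>i\<in>DT n s. x i) * (\<Prod>i\<in>AT n s. y i) * (\<Prod>i\<in>DTS n s. z i) * (\<Prod>i\<in>ATS n s. w i))"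

end

theory Submission
  imports Defs "HOL-Combinatorics.Multiset_Permutations"
    "HOL-Computational_Algebra.Fundamental_Theorem_Algebra"
begin

text \<open>Summing over the bars first turns \<open>\<alpha>\<^sub>n(x,y,z,w)\<close> into \<open>A\<^sub>n(x+z, y+w)\<close>, where \<open>A\<^sub>n\<close> sums the
  weights of plain permutations (\<open>x\<close> for descent tops, \<open>y\<close> for ascent tops). Inserting the letter
  \<open>n+1\<close> everywhere gives \<open>A\<^sub>n\<^sub>+\<^sub>1 = (x\<^sub>n\<^sub>+\<^sub>1 + y\<^sub>n\<^sub>+\<^sub>1) A\<^sub>n + x\<^sub>n\<^sub>+\<^sub>1 y\<^sub>n\<^sub>+\<^sub>1 D A\<^sub>n\<close>, where \<open>D\<close> is the derivative in the
  direction \<open>(1,\<dots>,1)\<close>. By induction the univariate polynomial \<open>p(t) = A\<^sub>n(x+t, y+t)\<close> has all its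
  zeros in the open lower half-plane, so \<open>p'(0)/p(0)\<close> has nonpositive imaginary part, while
  \<open>1/x\<^sub>n\<^sub>+\<^sub>1 + 1/y\<^sub>n\<^sub>+\<^sub>1\<close> has negative imaginary part; hence their sum is nonzero.\<close>

section \<open>Logarithmic derivative of a polynomial with all zeros in the open lower
  half-plane\<close>

lemma Im_divide_neg:
  assumes "Im z > 0" shows "Im (1 / z) < 0"
  using assms by (auto simp: Im_divide divide_neg_pos sum_power2_gt_zero_iff)

text \<open>Over the complex numbers, \<open>p'/p\<close> at 0 is the sum of \<open>1 / (-r)\<close>
  over the roots \<open>r\<close> with multiplicity. Each \<open>-r\<close> lies in the open upper
  half-plane, so each summand has negative imaginary part. The induction splits off one root at a
  time.\<close>

lemma Im_logderiv_nonpos: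
  fixes p :: "complex poly"
  assumes "\<And>t. Im t \<ge> 0 \<Longrightarrow> poly p t \<noteq> 0"
  shows "Im (poly (pderiv p) 0 / poly p 0) \<le> 0"
  using assms
proof (induction "degree p" arbitrary: p rule: less_induct)
  case less
  show ?case
  proof (cases "degree p = 0")
    case True
    then have "pderiv p = 0" by (simp add: pderiv_eq_0_iff)
    then show ?thesis by simp
  next
    case False
    then have "\<not> constant (poly p)"
      by (simp add: constant_degree)
    then obtain r where r: "poly p r = 0"
      using fundamental_theorem_of_algebra by blast
    then obtain q where q: "p = [:-r, 1:] * q"
      by (auto simp: poly_eq_0_iff_dvd)
    have p0: "p \<noteq> 0" using less.prems[of 0] by auto
    then have "q \<noteq> 0" using q by auto
    then have "degree p = Suc (degree q)"
      unfolding q by (subst degree_mult_eq) auto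
    moreover have qt: "poly q t \<noteq> 0" if "Im t \<ge> 0" for t
      using less.prems[OF that] by (auto simp: q)
    ultimately have IH: "Im (poly (pderiv q) 0 / poly q 0) \<le> 0"
      by (intro less.hyps) auto
    have "Im r < 0" using less.prems[of r] r by force
    then have Im_r: "Im (1 / (-r)) < 0" by (intro Im_divide_neg) simp
    have "r \<noteq> 0" using \<open>Im r < 0\<close> by auto
    have "poly (pderiv p) 0 / poly p 0 = 1 / (-r) + poly (pderiv q) 0 / poly q 0"
      using \<open>r \<noteq> 0\<close> qt[of 0] unfolding q pderiv_mult
      by (simp add: pderiv_pCons field_simps)
    then show ?thesis using IH Im_r by simp
  qed
qed

section \<open>Weights of words and insertion of a largest letter\<close>

fun link_weight :: "('b \<Rightarrow> 'b \<Rightarrow> 'a) \<Rightarrow> 'b list \<Rightarrow> 'a::comm_semiring_1" where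
  "link_weight f (a # b # l) = f a b * link_weight f (b # l)"
| "link_weight f l = 1"

lemma link_weight_map_upt:
  "link_weight f (map \<sigma> [m..<Suc (m + k)]) = (\<Prod>i\<in>{m..<m + k}. f (\<sigma> i) (\<sigma> (i + 1)))"
proof (induction k arbitrary: m)
  case (Suc k)
  have "[m..<Suc (m + Suc k)] = m # Suc m # [Suc (Suc m)..<Suc (Suc m + k)]"
    and "[Suc m..<Suc (Suc m + k)] = Suc m # [Suc (Suc m)..<Suc (Suc m + k)]"
    by (simp_all add: upt_conv_Cons del: upt_Suc)
  moreover have "{m..<m + Suc k} = insert m {Suc m..<Suc m + k}" by auto
  ultimately show ?case using Suc.IH[of "Suc m"] by (simp del: upt_Suc)
qed simp

lemma poly_link_weight:
  "poly (link_weight f l) t = link_weight (\<lambda>a b. poly (f a b) t) l"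
  by (induction f l rule: link_weight.induct) auto

definition top_weight :: "(nat \<Rightarrow> 'a) \<Rightarrow> (nat \<Rightarrow> 'a) \<Rightarrow> nat \<Rightarrow> nat \<Rightarrow> 'a" where
  "top_weight x y a b = (if a > b then x a else y b)"

text \<open>The variable \<open>x i\<close> moved by an indeterminate \<open>t\<close>. Polymorphic
  weights evaluated at these polynomials turn the derivative in direction (1,...,1) into
  \<open>pderiv\<close> at 0.\<close>

definition shift_poly :: "(nat \<Rightarrow> 'a) \<Rightarrow> nat \<Rightarrow> 'a::comm_semiring_1 poly" where
  "shift_poly x i = [:x i, 1:]"

lemma poly_top_weight_shift:
  "poly (top_weight (shift_poly x) (shift_poly y) a b) t
     = top_weight (\<lambda>i. x i + t) (\<lambda>i. y i + t) a b"
  by (simp add: top_weight_def shift_poly_def)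

text \<open>Every link, descent or ascent, has slope 1, so by Leibniz the derivative of a word's
  weight is the sum of its products with one link omitted.\<close>

lemma pderiv_top_weight_shift:
  "pderiv (top_weight (shift_poly x) (shift_poly y) a b) = (1 :: 'a::idom poly)"
  by (simp add: top_weight_def shift_poly_def pderiv_pCons)

definition insert_at :: "nat \<Rightarrow> 'b \<Rightarrow> 'b list \<Rightarrow> 'b list" where
  "insert_at k m l = take k l @ m # drop k l"

text \<open>Putting \<open>m\<close> between two neighbours deletes their link and creates an ascent
  to \<open>m\<close> and a descent from \<open>m\<close>, hence a factor \<open>x m * y m\<close>;
  summed over all gaps this is the derivative term. At the end of the word \<open>m\<close> only
  adds the factor \<open>y m\<close>. Fixing the head \<open>a\<close> leaves out insertion at the
  front.\<close>

lemma sum_insert_at_tail: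
  fixes x y :: "nat \<Rightarrow> 'a::idom"
  assumes "\<And>c. c \<in> set (a # l) \<Longrightarrow> c < m"
  defines "P \<equiv> link_weight (top_weight (shift_poly x) (shift_poly y))"
  shows "(\<Sum>k\<le>length l. link_weight (top_weight x y) (a # insert_at k m l))
    = y m * link_weight (top_weight x y) (a # l) + x m * y m * poly (pderiv (P (a # l))) 0"
  using assms(1)
proof (induction l arbitrary: a)
  case Nil
  then show ?case by (simp add: insert_at_def top_weight_def P_def)
next
  case (Cons b l)
  let ?W = "link_weight (top_weight x y)"
  have IH: "(\<Sum>k\<le>length l. ?W (b # insert_at k m l))
    = y m * ?W (b # l) + x m * y m * poly (pderiv (P (b # l))) 0"
    using Cons by auto
  have P: "poly (P (b # l)) 0 = ?W (b # l)"
    by (simp add: P_def poly_link_weight poly_top_weight_shift)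
  have D: "poly (pderiv (P (a # b # l))) 0
      = ?W (b # l) + top_weight x y a b * poly (pderiv (P (b # l))) 0"
    using P by (simp add: P_def pderiv_mult pderiv_top_weight_shift poly_top_weight_shift)
  \<comment> \<open>For \<open>k = 0\<close> the link from \<open>a\<close> to \<open>b\<close> is
    broken; all later insertions keep it as a common factor.\<close>
  have "(\<Sum>k\<le>length (b # l). ?W (a # insert_at k m (b # l)))
      = ?W (a # m # b # l) + (\<Sum>k\<le>length l. ?W (a # b # insert_at k m l))"
    by (simp only: length_Cons sum.atMost_Suc_shift) (simp add: insert_at_def)
  also have "?W (a # m # b # l) = x m * y m * ?W (b # l)"
    using Cons.prems[of a] Cons.prems[of b] by (simp add: top_weight_def)
  also have "(\<Sum>k\<le>length l. ?W (a # b # insert_at k m l))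
      = top_weight x y a b * (\<Sum>k\<le>length l. ?W (b # insert_at k m l))"
    by (simp add: sum_distrib_left)
  finally show ?case unfolding IH D by (simp add: algebra_simps)
qed

lemma sum_insert_at:
  fixes x y :: "nat \<Rightarrow> 'a::idom"
  assumes "\<And>c. c \<in> set l \<Longrightarrow> c < m" and "l \<noteq> []"
  shows "(\<Sum>k\<le>length l. link_weight (top_weight x y) (insert_at k m l))
    = (x m + y m) * link_weight (top_weight x y) l
      + x m * y m * poly (pderiv (link_weight (top_weight (shift_poly x) (shift_poly y)) l)) 0"
proof -
  obtain a l' where l: "l = a # l'" using assms(2) by (cases l) auto
  let ?W = "link_weight (top_weight x y)"
  have "(\<Sum>k\<le>length l. ?W (insert_at k m l))
      = ?W (m # a # l') + (\<Sum>k\<le>length l'. ?W (a # insert_at k m l'))"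
    unfolding l by (simp only: length_Cons sum.atMost_Suc_shift) (simp add: insert_at_def)
  also have "?W (m # a # l') = x m * ?W l"
    using assms(1)[of a] by (simp add: l top_weight_def)
  finally show ?thesis
    using sum_insert_at_tail[of a l' m x y] assms(1) by (simp add: l algebra_simps)
qed

text \<open>Deleting \<open>m\<close> and measuring the prefix before it undoes the insertion.
  Surjectivity then follows by counting, as
  \<open>(card S + 1) * fact (card S) = fact (card S + 1)\<close>.\<close>

lemma bij_betw_insert_at:
  assumes "finite S" and "m \<notin> S"
  shows "bij_betw (\<lambda>(l, k). insert_at k m l) (permutations_of_set S \<times> {..card S})
           (permutations_of_set (insert m S))"
proof -
  let ?g = "\<lambda>(l, k). insert_at k m l"
  let ?A = "permutations_of_set S \<times> {..card S}"
  have inj: "inj_on ?g ?A"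
  proof (rule inj_on_inverseI[where g = "\<lambda>l. (remove1 m l, length (takeWhile (\<lambda>c. c \<noteq> m) l))"])
    fix lk assume lk: "lk \<in> ?A"
    obtain l k where [simp]: "lk = (l, k)" by (cases lk)
    have l: "set l = S" "distinct l" "k \<le> length l"
      using lk by (auto simp: permutations_of_set_def distinct_card)
    have t: "m \<notin> set (take k l)" using l assms(2) by (auto dest: in_set_takeD)
    have "takeWhile (\<lambda>c. c \<noteq> m) (take k l @ m # drop k l) = take k l"
      using t by (auto simp: takeWhile_append)
    then show "(remove1 m (?g lk), length (takeWhile (\<lambda>c. c \<noteq> m) (?g lk))) = lk"
      using t l(3) by (simp add: insert_at_def remove1_append)
  qed
  have "insert_at k m l \<in> permutations_of_set (insert m S)"
    if l: "l \<in> permutations_of_set S" for l k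
  proof -
    have "set (insert_at k m l) = insert m (set (take k l @ drop k l))"
      unfolding insert_at_def by (simp only: set_append list.set Un_insert_right)
    moreover have "distinct (insert_at k m l) \<longleftrightarrow> distinct (m # take k l @ drop k l)"
      unfolding insert_at_def by (auto simp del: append_take_drop_id)
    ultimately show ?thesis
      using l assms(2) by (simp add: permutations_of_set_def)
  qed
  then have sub: "?g ` ?A \<subseteq> permutations_of_set (insert m S)" by auto
  have "card (permutations_of_set (insert m S)) = card (?g ` ?A)"
    using assms by (simp add: card_image[OF inj] card_cartesian_product)
  then have "?g ` ?A = permutations_of_set (insert m S)"
    using sub assms(1) by (intro card_subset_eq) auto
  with inj show ?thesis by (simp add: bij_betw_def)
qed

text \<open>Passes from permutations as functions to their one-line words. A permutation is the
  identity off \<open>set xs\<close>, which gives injectivity; both sides have the same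
  cardinality.\<close>

lemma bij_betw_map_permutations_of_set:
  assumes "distinct xs"
  shows "bij_betw (\<lambda>\<sigma>. map \<sigma> xs) {\<sigma>. \<sigma> permutes set xs} (permutations_of_set (set xs))"
proof -
  let ?A = "{\<sigma>. \<sigma> permutes set xs}"
  have inj: "inj_on (\<lambda>\<sigma>. map \<sigma> xs) ?A"
  proof (rule inj_onI, rule ext)
    fix \<sigma> \<tau> c assume "\<sigma> \<in> ?A" "\<tau> \<in> ?A" "map \<sigma> xs = map \<tau> xs"
    then show "\<sigma> c = \<tau> c" by (cases "c \<in> set xs") (auto simp: permutes_not_in)
  qed
  have sub: "(\<lambda>\<sigma>. map \<sigma> xs) ` ?A \<subseteq> permutations_of_set (set xs)"
    using assms
    by (auto simp: permutations_of_set_def distinct_map permutes_in_image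
        permutes_inj_on permutes_image)
  have "card (permutations_of_set (set xs)) = card ((\<lambda>\<sigma>. map \<sigma> xs) ` ?A)"
    by (simp add: card_image[OF inj] card_permutations[of "set xs" "card (set xs)"])
  then have "(\<lambda>\<sigma>. map \<sigma> xs) ` ?A = permutations_of_set (set xs)"
    using sub by (intro card_subset_eq) auto
  with inj show ?thesis by (simp add: bij_betw_def)
qed

section \<open>Recurrence and stability for plain permutations\<close>

definition tops_poly :: "nat \<Rightarrow> (nat \<Rightarrow> 'a) \<Rightarrow> (nat \<Rightarrow> 'a) \<Rightarrow> 'a::comm_semiring_1" where
  "tops_poly n x y = (\<Sum>l\<in>permutations_of_set {1..n}. link_weight (top_weight x y) l)"

lemma poly_tops_poly_shift:
  "poly (tops_poly n (shift_poly x) (shift_poly y)) t = tops_poly n (\<lambda>i. x i + t) (\<lambda>i. y i + t)"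
  by (simp add: tops_poly_def poly_sum poly_link_weight poly_top_weight_shift)

lemma tops_poly_Suc:
  fixes x y :: "nat \<Rightarrow> 'a::idom"
  assumes "n \<ge> 1"
  defines "m \<equiv> Suc n"
  shows "tops_poly m x y = (x m + y m) * tops_poly n x y
    + x m * y m * poly (pderiv (tops_poly n (shift_poly x) (shift_poly y))) 0"
proof -
  let ?W = "link_weight (top_weight x y)"
  let ?P = "link_weight (top_weight (shift_poly x) (shift_poly y))"
  have "{1..m} = insert m {1..n}" by (auto simp: m_def)
  then have "tops_poly m x y
      = (\<Sum>(l, k)\<in>permutations_of_set {1..n} \<times> {..n}. ?W (insert_at k m l))"
    using sum.reindex_bij_betw[OF bij_betw_insert_at[of "{1..n}" m], of ?W]
    by (simp add: tops_poly_def m_def case_prod_unfold)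
  also have "\<dots> = (\<Sum>l\<in>permutations_of_set {1..n}. \<Sum>k\<le>n. ?W (insert_at k m l))"
    by (simp add: sum.cartesian_product)
  also have "\<dots> = (\<Sum>l\<in>permutations_of_set {1..n}.
      (x m + y m) * ?W l + x m * y m * poly (pderiv (?P l)) 0)"
  proof (rule sum.cong[OF refl])
    fix l assume "l \<in> permutations_of_set {1..n}"
    then have l: "set l = {1..n}" "length l = n"
      by (auto simp: permutations_of_set_def dest: distinct_card)
    moreover have "l \<noteq> []" using l assms by auto
    ultimately show "(\<Sum>k\<le>n. ?W (insert_at k m l))
        = (x m + y m) * ?W l + x m * y m * poly (pderiv (?P l)) 0"
      using sum_insert_at[of l m x y] assms by (auto simp: m_def)
  qed
  \<comment> \<open>The instance of \<open>higher_pderiv_sum\<close> is additivity of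
    \<open>pderiv\<close> over finite sums.\<close>
  finally show ?thesis
    by (simp add: tops_poly_def sum.distrib sum_distrib_left poly_sum higher_pderiv_sum[where n = 1, simplified])
qed

lemma tops_poly_stable:
  fixes x y :: "nat \<Rightarrow> complex"
  assumes "n \<ge> 1"
    and "\<And>i. i \<in> {1..n} \<Longrightarrow> Im (x i) > 0"
    and "\<And>i. i \<in> {1..n} \<Longrightarrow> Im (y i) > 0"
  shows "tops_poly n x y \<noteq> 0"
  using assms
proof (induction n arbitrary: x y rule: dec_induct)
  case base
  have "permutations_of_set {1..1::nat} = {[1]}" by simp
  then show ?case by (simp add: tops_poly_def)
next
  case (step n)
  define p where "p = tops_poly n (shift_poly x) (shift_poly y)"
  define a b where "a = x (Suc n)" and "b = y (Suc n)"
  have pt: "poly p t = tops_poly n (\<lambda>i. x i + t) (\<lambda>i. y i + t)" for t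
    by (simp add: p_def poly_tops_poly_shift)
  \<comment> \<open>A shift by \<open>t\<close> with \<open>Im t \<ge> 0\<close> keeps all variables
    in the open upper half-plane, so the induction hypothesis applies to the shifted
    variables.\<close>
  have nz: "poly p t \<noteq> 0" if "Im t \<ge> 0" for t
    unfolding pt by (rule step.IH) (use that step.prems in \<open>auto intro: add_pos_nonneg\<close>)
  have "Im (poly (pderiv p) 0 / poly p 0) \<le> 0"
    using nz by (rule Im_logderiv_nonpos)
  moreover have Im: "Im a > 0" "Im b > 0" using step.prems by (auto simp: a_def b_def)
  ultimately have "Im (1 / a + 1 / b + poly (pderiv p) 0 / poly p 0) < 0"
    using Im_divide_neg[of a] Im_divide_neg[of b] by simp
  then have ne: "1 / a + 1 / b + poly (pderiv p) 0 / poly p 0 \<noteq> 0" by force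
  have ab: "a \<noteq> 0" "b \<noteq> 0" using Im by auto
  have "tops_poly (Suc n) x y = (a + b) * poly p 0 + a * b * poly (pderiv p) 0"
    using tops_poly_Suc[OF step.hyps(1), of x y] pt[of 0] by (simp add: p_def a_def b_def)
  also have "\<dots> = a * b * poly p 0 * (1 / a + 1 / b + poly (pderiv p) 0 / poly p 0)"
    using ab nz[of 0] by (simp add: field_simps)
  finally show ?case using ne ab nz[of 0] by simp
qed

section \<open>Summing out the bars\<close>

lemma prod_over_tops:
  fixes f :: "nat \<Rightarrow> 'a::comm_semiring_1"
  assumes "inj \<tau>" and "finite I"
  shows "(\<Prod>j\<in>{\<tau> i | i. i \<in> I \<and> Q i}. f j) = (\<Prod>i\<in>I. if Q i then f (\<tau> i) else 1)"
proof -
  have "{\<tau> i | i. i \<in> I \<and> Q i} = \<tau> ` {i \<in> I. Q i}" by auto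
  then show ?thesis
    using assms by (simp add: prod.reindex inj_on_subset prod.inter_filter)
qed

lemma segmented_weight:
  fixes x y z w :: "nat \<Rightarrow> 'a::comm_semiring_1"
  assumes "\<sigma> permutes {1..n}" and "B \<subseteq> {1..<n}"
  shows "(\<Prod>i\<in>DT n (\<sigma>, B). x i) * (\<Prod>i\<in>AT n (\<sigma>, B). y i)
       * (\<Prod>i\<in>DTS n (\<sigma>, B). z i) * (\<Prod>i\<in>ATS n (\<sigma>, B). w i)
     = (\<Prod>i\<in>B. top_weight z w (\<sigma> i) (\<sigma> (i + 1)))
       * (\<Prod>i\<in>{1..<n} - B. top_weight x y (\<sigma> i) (\<sigma> (i + 1)))"
proof -
  let ?g = "\<lambda>i. if i \<in> B then top_weight z w (\<sigma> i) (\<sigma> (i + 1))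
                else top_weight x y (\<sigma> i) (\<sigma> (i + 1))"
  have inj: "inj \<sigma>" using assms(1) by (rule permutes_inj)
  then have inj': "inj (\<lambda>i. \<sigma> (i + 1))" by (auto simp: inj_def)
  \<comment> \<open>\<open>top_weight\<close> would count a tie as an ascent. Without ties, each
    slot contributes to exactly one of the four statistics.\<close>
  have ne: "\<sigma> i \<noteq> \<sigma> (i + 1)" for i using inj_eq[OF inj, of i "i + 1"] by simp
  have "(\<Prod>i\<in>DT n (\<sigma>, B). x i) * (\<Prod>i\<in>AT n (\<sigma>, B). y i)
       * (\<Prod>i\<in>DTS n (\<sigma>, B). z i) * (\<Prod>i\<in>ATS n (\<sigma>, B). w i) = (\<Prod>i\<in>{1..<n}. ?g i)"
    unfolding DT_def AT_def DTS_def ATS_def prod.case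
    unfolding prod_over_tops[OF inj finite_atLeastLessThan]
      prod_over_tops[OF inj' finite_atLeastLessThan] prod.distrib[symmetric]
    by (intro prod.cong refl) (use ne in \<open>auto simp: top_weight_def not_less le_less\<close>)
  also have "\<dots> = (\<Prod>i\<in>{1..<n} - B. ?g i) * (\<Prod>i\<in>B. ?g i)"
    using assms(2) by (intro prod.subset_diff) auto
  finally show ?thesis by (simp add: mult.commute)
qed

lemma alpha_eq_tops_poly:
  fixes x y z w :: "nat \<Rightarrow> 'a::comm_semiring_1"
  assumes "n \<ge> 1"
  shows "alpha n x y z w = tops_poly n (\<lambda>i. x i + z i) (\<lambda>i. y i + w i)"
proof -
  let ?f = "top_weight x y" and ?g = "top_weight z w"
  let ?h = "top_weight (\<lambda>i. x i + z i) (\<lambda>i. y i + w i)"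
  let ?S = "{\<sigma>. \<sigma> permutes {1..n}}"
  have SP: "SP n = ?S \<times> Pow {1..<n}" by (auto simp: SP_def)
  \<comment> \<open>A word of \<open>n\<close> letters has \<open>n - 1\<close> links; this is the
    shape that \<open>link_weight_map_upt\<close> expects.\<close>
  have upt: "[1..<Suc n] = [1..<Suc (1 + (n - 1))]" "{1..<n} = {1..<1 + (n - 1)}"
    using assms by auto
  have "alpha n x y z w = (\<Sum>\<sigma>\<in>?S. \<Sum>B\<in>Pow {1..<n}.
      (\<Prod>i\<in>B. ?g (\<sigma> i) (\<sigma> (i + 1))) * (\<Prod>i\<in>{1..<n} - B. ?f (\<sigma> i) (\<sigma> (i + 1))))"
    unfolding alpha_def SP sum.cartesian_product
    by (intro sum.cong refl) (auto simp: segmented_weight)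
  \<comment> \<open>The bars are chosen independently slot by slot, so the sum over \<open>B\<close>
    is an expanded product of binomials.\<close>
  also have "\<dots> = (\<Sum>\<sigma>\<in>?S. \<Prod>i\<in>{1..<n}. ?g (\<sigma> i) (\<sigma> (i + 1)) + ?f (\<sigma> i) (\<sigma> (i + 1)))"
    by (simp add: prod_add)
  \<comment> \<open>The letters alone decide which branch of \<open>top_weight\<close> applies, so
    the two weights add within that branch.\<close>
  also have "\<dots> = (\<Sum>\<sigma>\<in>?S. \<Prod>i\<in>{1..<n}. ?h (\<sigma> i) (\<sigma> (i + 1)))"
    by (intro sum.cong prod.cong refl) (auto simp: top_weight_def add.commute)
  also have "\<dots> = (\<Sum>\<sigma>\<in>?S. link_weight ?h (map \<sigma> [1..<Suc n]))"
    unfolding upt link_weight_map_upt ..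
  also have "\<dots> = tops_poly n (\<lambda>i. x i + z i) (\<lambda>i. y i + w i)"
    using sum.reindex_bij_betw[OF bij_betw_map_permutations_of_set[of "[1..<Suc n]"],
        of "link_weight ?h"]
    by (simp add: tops_poly_def atLeastLessThanSuc_atLeastAtMost del: upt_Suc)
  finally show ?thesis .
qed

theorem theorem3p2:
  fixes n :: nat and x y z w :: "nat \<Rightarrow> complex"
  assumes "n \<ge> 1"
    and "\<And>i. i \<in> {1..n} \<Longrightarrow> Im (x i) > 0"
    and "\<And>i. i \<in> {1..n} \<Longrightarrow> Im (y i) > 0"
    and "\<And>i. i \<in> {1..n} \<Longrightarrow> Im (z i) > 0"
    and "\<And>i. i \<in> {1..n} \<Longrightarrow> Im (w i) > 0"
  shows "alpha n x y z w \<noteq> 0"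
  unfolding alpha_eq_tops_poly[OF assms(1)]
  using assms by (intro tops_poly_stable) (auto intro: add_pos_pos)

end
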